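(* For any $n\in\mathbb{N}$, the spectral measure $\nu_{\Omega,\Omega}$ is basic on the Gelfand spectrum $\mathrm{sp}(\mathcal{S}_n)$, where $\mathcal{S}_n$ is the unital abelian $C^*$-algebra of operators on the discrete monotone Fock space $\mathcal{F}_m$ generated by $S_n=\sum_{i=1}^n s_i$.
   Context: $\mathbb{N}=\{1,2,3,\ldots\}$. For $k\ge1$ let $I_k:=\{(i_1,\ldots,i_k): i_1<i_2<\cdots<i_k,\ i_j\in\mathbb{N}\}$. The discrete monotone Fock space is the Hilbert space $\mathcal{F}_m:=\bigoplus_{k\ge0}\mathcal{H}_k$, with $\mathcal{H}_0=\mathbb{C}\Omega$ ($\Omega$ a unit vector, the vacuum) and $\mathcal{H}_k=\ell^2(I_k)$ for $k\ge1$; its canonical orthonormal basis consists of $\Omega$ and the vectors $e_{(i_1,\ldots,i_k)}$, $(i_1,\ldots,i_k)\in I_k$, $k\ge 1$ (write $e_i=e_{(i)}$). For $i\in\mathbb{N}$ the monotone creation operator $a_i^\dagger$ and annihilation operator $a_i$ are the bounded, mutually adjoint operators with $a_i^\dagger\Omega=e_i$, $a_i\Omega=0$; $a_i^\dagger e_{(i_1,\ldots,i_k)}=e_{(i,i_1,\ldots,i_k)}$ if $i<i_1$ and $0$ otherwise; $a_i e_{(i_1,\ldots,i_k)}=e_{(i_2,\ldots,i_k)}$ if $i=i_1$ and $0$ otherwise (with $a_ie_i=\Omega$). The position operator is $s_i:=a_i+a_i^\dagger$. For a unital abelian $C^*$-algebra $\mathfrak{A}$ of operators on a Hilbert space $\mathcal{H}$,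 $\mathrm{sp}(\mathfrak{A})$ is the weak-$*$ compact space of characters, and for $f\in C(\mathrm{sp}(\mathfrak{A}))$, $T_f\in\mathfrak{A}$ is the unique element with $\varphi(T_f)=f(\varphi)$ for all characters $\varphi$ (Gelfand isomorphism). For $x,y\in\mathcal{H}$ the spectral measure $\nu_{x,y}$ on $\mathrm{sp}(\mathfrak{A})$ is the Radon measure with $\int f\,d\nu_{x,y}=\langle T_fx,y\rangle$ for all $f\in C(\mathrm{sp}(\mathfrak{A}))$. A positive Radon measure $\mu$ on $\mathrm{sp}(\mathfrak{A})$ is called basic if, for every subset $N\subseteq\mathrm{sp}(\mathfrak{A})$, $N$ is locally $\mu$-negligible if and only if $N$ is locally $\nu_{x,x}$-negligible for all $x\in\mathcal{H}$. *)

theory Defs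
  imports "HOL-Analysis.Analysis"
begin

section \<open>Complex \<open>\<ell>\<^sup>2\<close> spaces\<close>

typedef 'a ell2 = "{f :: 'a \<Rightarrow> complex. (\<lambda>i. (cmod (f i))\<^sup>2) summable_on UNIV}"
  morphisms coord Abs_ell2
  by (rule exI [of _ "\<lambda>_. 0"]) simp

setup_lifting type_definition_ell2

lemma sq_summable_add:
  fixes f g :: "'a \<Rightarrow> complex"
  assumes "(\<lambda>i. (cmod (f i))\<^sup>2) summable_on A" "(\<lambda>i. (cmod (g i))\<^sup>2) summable_on A"
  shows "(\<lambda>i. (cmod (f i + g i))\<^sup>2) summable_on A"
proof (rule summable_on_comparison_test)
  show "(\<lambda>i. 2 * (cmod (f i))\<^sup>2 + 2 * (cmod (g i))\<^sup>2) summable_on A"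
    by (intro summable_on_add summable_on_cmult_right assms)
next
  fix i
  have "(cmod (f i + g i))\<^sup>2 \<le> (cmod (f i) + cmod (g i))\<^sup>2"
    by (intro power_mono norm_triangle_ineq) auto
  also have "\<dots> \<le> 2 * (cmod (f i))\<^sup>2 + 2 * (cmod (g i))\<^sup>2"
    using zero_le_power2 [of "cmod (f i) - cmod (g i)"]
    unfolding power2_sum power2_diff by linarith
  finally show "(cmod (f i + g i))\<^sup>2 \<le> 2 * (cmod (f i))\<^sup>2 + 2 * (cmod (g i))\<^sup>2" .
qed auto

lemma sq_summable_scale:
  fixes f :: "'a \<Rightarrow> complex"
  assumes "(\<lambda>i. (cmod (f i))\<^sup>2) summable_on A"
  shows "(\<lambda>i. (cmod (c * f i))\<^sup>2) summable_on A"
  using summable_on_cmult_right [OF assms, of "(cmod c)\<^sup>2"]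
  by (simp add: norm_mult power_mult_distrib)

lemma sq_summable_coord: "(\<lambda>i. (cmod (coord x i))\<^sup>2) summable_on UNIV"
  using coord [of x] by simp

lemma coord_inject_ext: "x = y \<longleftrightarrow> (\<forall>i. coord x i = coord y i)"
  by (metis coord_inject ext)

lift_definition cscale :: "complex \<Rightarrow> 'a ell2 \<Rightarrow> 'a ell2" (infixr \<open>*\<^sub>C\<close> 75)
  is "\<lambda>c f i. c * f i"
  by (rule sq_summable_scale)

lift_definition ket :: "'a \<Rightarrow> 'a ell2" is "\<lambda>a i. if i = a then 1 else 0"
proof -
  fix a :: 'a
  show "(\<lambda>i. (cmod (if i = a then 1 else 0))\<^sup>2) summable_on UNIV"
    by (rule finite_nonzero_values_imp_summable_on) (auto intro: finite_subset [of _ "{a}"])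
qed

text \<open>The inner product is linear in the first argument, so that
  \<open>T \<mapsto> \<langle>T x, y\<rangle>\<close> is a linear functional.\<close>

definition cinner :: "'a ell2 \<Rightarrow> 'a ell2 \<Rightarrow> complex" where
  "cinner x y = (\<Sum>\<^sub>\<infinity>i. coord x i * cnj (coord y i))"

lemma cinner_summable:
  "(\<lambda>i. coord x i * cnj (coord y i)) summable_on UNIV"
proof (rule abs_summable_summable, rule summable_on_comparison_test)
  show "(\<lambda>i. (cmod (coord x i))\<^sup>2 + (cmod (coord y i))\<^sup>2) summable_on UNIV"
    by (intro summable_on_add sq_summable_coord)
next
  fix i
  have "2 * (cmod (coord x i) * cmod (coord y i)) \<le> (cmod (coord x i))\<^sup>2 + (cmod (coord y i))\<^sup>2"
    using zero_le_power2 [of "cmod (coord x i) - cmod (coord y i)"]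
    unfolding power2_diff by linarith
  moreover have "0 \<le> cmod (coord x i) * cmod (coord y i)"
    by simp
  ultimately show "norm (coord x i * cnj (coord y i))
      \<le> (cmod (coord x i))\<^sup>2 + (cmod (coord y i))\<^sup>2"
    unfolding norm_mult complex_mod_cnj by linarith
qed auto

instantiation ell2 :: (type) real_inner
begin

lift_definition zero_ell2 :: "'a ell2" is "\<lambda>_. 0" by simp
lift_definition plus_ell2 :: "'a ell2 \<Rightarrow> 'a ell2 \<Rightarrow> 'a ell2" is "\<lambda>f g i. f i + g i"
  by (rule sq_summable_add)
lift_definition uminus_ell2 :: "'a ell2 \<Rightarrow> 'a ell2" is "\<lambda>f i. - f i"
  by simp
definition minus_ell2 :: "'a ell2 \<Rightarrow> 'a ell2 \<Rightarrow> 'a ell2" where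
  "x - y = x + (- y)" for x y :: "'a ell2"
definition scaleR_ell2 :: "real \<Rightarrow> 'a ell2 \<Rightarrow> 'a ell2" where
  "scaleR_ell2 r x = complex_of_real r *\<^sub>C x"
definition inner_ell2 :: "'a ell2 \<Rightarrow> 'a ell2 \<Rightarrow> real" where
  "inner_ell2 x y = Re (cinner x y)"
definition norm_ell2 :: "'a ell2 \<Rightarrow> real" where
  "norm_ell2 x = sqrt (inner x x)"
definition sgn_ell2 :: "'a ell2 \<Rightarrow> 'a ell2" where
  "sgn_ell2 x = scaleR (inverse (norm x)) x"
definition dist_ell2 :: "'a ell2 \<Rightarrow> 'a ell2 \<Rightarrow> real" where
  "dist_ell2 x y = norm (x - y)"
definition uniformity_ell2 :: "('a ell2 \<times> 'a ell2) filter" where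
  "uniformity_ell2 = (INF e\<in>{0<..}. principal {(x, y). dist x y < e})"
definition open_ell2 :: "'a ell2 set \<Rightarrow> bool" where
  "open_ell2 U = (\<forall>x\<in>U. \<forall>\<^sub>F (x', y) in uniformity. x' = x \<longrightarrow> y \<in> U)"

lemma inner_self_ell2: "inner x x = (\<Sum>\<^sub>\<infinity>i. (cmod (coord x i))\<^sup>2)" for x :: "'a ell2"
proof -
  have "Re (z * cnj z) = (cmod z)\<^sup>2" for z
    by (simp add: cmod_power2 flip: power2_eq_square)
  then show ?thesis
    unfolding inner_ell2_def cinner_def infsum_Re [OF cinner_summable, symmetric] by simp
qed

instance
proof
  fix x y z :: "'a ell2" and r s :: real
  show "x + y + z = x + (y + z)" "x + y = y + x" "0 + x = x" "- x + x = 0"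
    by (transfer; simp add: fun_eq_iff)+
  show "x - y = x + - y"
    by (rule minus_ell2_def)
  show "r *\<^sub>R (x + y) = r *\<^sub>R x + r *\<^sub>R y" "(r + s) *\<^sub>R x = r *\<^sub>R x + s *\<^sub>R x"
    "r *\<^sub>R s *\<^sub>R x = (r * s) *\<^sub>R x" "1 *\<^sub>R x = x"
    unfolding scaleR_ell2_def by (transfer; simp add: fun_eq_iff algebra_simps)+
  show "sgn x = scaleR (inverse (norm x)) x"
    by (rule sgn_ell2_def)
  show "dist x y = norm (x - y)"
    by (rule dist_ell2_def)
  show "uniformity = (INF e\<in>{0<..}. principal {(x, y). dist x y < e} :: ('a ell2 \<times> 'a ell2) filter)"
    by (rule uniformity_ell2_def)
  show "open U = (\<forall>x\<in>U. \<forall>\<^sub>F (x', y) in uniformity. x' = x \<longrightarrow> y \<in> U)" for U :: "'a ell2 set"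
    by (rule open_ell2_def)
  show "norm x = sqrt (inner x x)"
    by (rule norm_ell2_def)
  have "cinner y x = cnj (cinner x y)"
    unfolding cinner_def infsum_cnj [symmetric] by (simp add: mult.commute)
  then show "inner x y = inner y x"
    by (simp add: inner_ell2_def)
  have "cinner (x + y) z = cinner x z + cinner y z"
    unfolding cinner_def infsum_add [OF cinner_summable cinner_summable, symmetric]
    by (simp add: plus_ell2.rep_eq distrib_right)
  then show "inner (x + y) z = inner x z + inner y z"
    by (simp add: inner_ell2_def)
  have "cinner (complex_of_real r *\<^sub>C x) y = complex_of_real r * cinner x y"
    unfolding cinner_def by (simp add: cscale.rep_eq mult.assoc infsum_cmult_right')
  then show "inner (r *\<^sub>R x) y = r * inner x y"
    by (simp add: inner_ell2_def scaleR_ell2_def)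
  show "0 \<le> inner x x"
    unfolding inner_self_ell2 by (rule infsum_nonneg) simp
  show "inner x x = 0 \<longleftrightarrow> x = 0"
  proof
    assume "inner x x = 0"
    then have "(cmod (coord x i))\<^sup>2 = 0" for i
      unfolding inner_self_ell2
      by (intro nonneg_infsum_le_0D [where A = UNIV]) (auto intro: sq_summable_coord)
    then show "x = 0"
      by (simp add: coord_inject_ext zero_ell2.rep_eq)
  qed (simp add: inner_self_ell2 zero_ell2.rep_eq)
qed

end

lemma norm_ell2: "norm x = sqrt (\<Sum>\<^sub>\<infinity>i. (cmod (coord x i))\<^sup>2)" for x :: "'a ell2"
  by (simp add: norm_ell2_def inner_self_ell2)

lemma sum_coord_le_norm:
  fixes x :: "'a ell2"
  assumes "finite F"
  shows "(\<Sum>i\<in>F. (cmod (coord x i))\<^sup>2) \<le> (norm x)\<^sup>2"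
proof -
  have "(\<Sum>i\<in>F. (cmod (coord x i))\<^sup>2) \<le> (\<Sum>\<^sub>\<infinity>i. (cmod (coord x i))\<^sup>2)"
    by (rule finite_sum_le_infsum) (auto intro: sq_summable_coord assms)
  then show ?thesis
    by (simp add: norm_ell2 infsum_nonneg)
qed

lemma coord_le_norm: "cmod (coord x i) \<le> norm x"
  using sum_coord_le_norm [of "{i}" x] by (auto intro: power2_le_imp_le)

lemma coord_minus: "coord (x - y) i = coord x i - coord y i"
  unfolding minus_ell2_def by (simp only: plus_ell2.rep_eq uminus_ell2.rep_eq) simp

instance ell2 :: (type) complete_space
proof
  fix X :: "nat \<Rightarrow> 'a ell2"
  assume X: "Cauchy X"
  have "Cauchy (\<lambda>n. coord (X n) i)" for i
  proof (rule metric_CauchyI)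
    fix e :: real
    assume "0 < e"
    then obtain M where M: "\<And>m n. m \<ge> M \<Longrightarrow> n \<ge> M \<Longrightarrow> dist (X m) (X n) < e"
      using metric_CauchyD [OF X] by blast
    have "dist (coord (X m) i) (coord (X n) i) \<le> dist (X m) (X n)" for m n
      using coord_le_norm [of "X m - X n" i] by (simp add: dist_norm coord_minus)
    then show "\<exists>M. \<forall>m\<ge>M. \<forall>n\<ge>M. dist (coord (X m) i) (coord (X n) i) < e"
      using M by (meson le_less_trans)
  qed
  then have "\<forall>i. \<exists>l. (\<lambda>n. coord (X n) i) \<longlonglongrightarrow> l"
    by (simp add: Cauchy_convergent_iff convergent_def)
  then obtain g where g: "\<And>i. (\<lambda>n. coord (X n) i) \<longlonglongrightarrow> g i"
    by metis
  have bound: "\<exists>M. \<forall>n\<ge>M. \<forall>F. finite F \<longrightarrow> (\<Sum>i\<in>F. (cmod (coord (X n) i - g i))\<^sup>2) \<le> e\<^sup>2"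
    if "0 < e" for e
  proof -
    obtain M where M: "\<And>m n. m \<ge> M \<Longrightarrow> n \<ge> M \<Longrightarrow> norm (X n - X m) < e"
      using metric_CauchyD [OF X \<open>0 < e\<close>] unfolding dist_norm by blast
    have "(\<Sum>i\<in>F. (cmod (coord (X n) i - g i))\<^sup>2) \<le> e\<^sup>2" if "n \<ge> M" "finite F" for n F
    proof (rule tendsto_upperbound)
      show "(\<lambda>m. \<Sum>i\<in>F. (cmod (coord (X n) i - coord (X m) i))\<^sup>2)
          \<longlonglongrightarrow> (\<Sum>i\<in>F. (cmod (coord (X n) i - g i))\<^sup>2)"
        by (intro tendsto_intros g)
      have "(\<Sum>i\<in>F. (cmod (coord (X n) i - coord (X m) i))\<^sup>2) \<le> e\<^sup>2" if "m \<ge> M" for m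
      proof -
        have "(norm (X n - X m))\<^sup>2 \<le> e\<^sup>2"
          using M [OF \<open>m \<ge> M\<close> \<open>n \<ge> M\<close>] by (intro power_mono) auto
        then show ?thesis
          using sum_coord_le_norm [OF \<open>finite F\<close>, of "X n - X m"] by (simp add: coord_minus)
      qed
      then show "\<forall>\<^sub>F m in sequentially. (\<Sum>i\<in>F. (cmod (coord (X n) i - coord (X m) i))\<^sup>2) \<le> e\<^sup>2"
        by (auto simp: eventually_sequentially)
    qed simp
    then show ?thesis
      by blast
  qed
  have diff: "(\<lambda>i. (cmod (coord (X n) i - g i))\<^sup>2) summable_on UNIV"
    if "\<And>F. finite F \<Longrightarrow> (\<Sum>i\<in>F. (cmod (coord (X n) i - g i))\<^sup>2) \<le> e" for n e
    using that by (intro nonneg_bdd_above_summable_on bdd_aboveI2 [where M = e]) auto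
  obtain N where N: "\<And>F. finite F \<Longrightarrow> (\<Sum>i\<in>F. (cmod (coord (X N) i - g i))\<^sup>2) \<le> 1\<^sup>2"
    using bound [of 1] by auto
  have "(\<lambda>i. (cmod (coord (X N) i + (-1) * (coord (X N) i - g i)))\<^sup>2) summable_on UNIV"
    by (intro sq_summable_add sq_summable_scale sq_summable_coord diff [OF N])
  then have Y: "coord (Abs_ell2 g) = g"
    by (intro Abs_ell2_inverse) simp
  have "X \<longlonglongrightarrow> Abs_ell2 g"
  proof (rule metric_LIMSEQ_I)
    fix r :: real
    assume "0 < r"
    then obtain M where M: "\<And>n F. n \<ge> M \<Longrightarrow> finite F \<Longrightarrow>
        (\<Sum>i\<in>F. (cmod (coord (X n) i - g i))\<^sup>2) \<le> (r / 2)\<^sup>2"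
      using bound [of "r / 2"] by auto
    have "dist (X n) (Abs_ell2 g) < r" if "n \<ge> M" for n
    proof -
      have "(\<Sum>\<^sub>\<infinity>i. (cmod (coord (X n) i - g i))\<^sup>2) \<le> (r / 2)\<^sup>2"
        using M [OF that] by (intro infsum_le_finite_sums diff [of n "(r / 2)\<^sup>2"]) auto
      then have "norm (X n - Abs_ell2 g) \<le> r / 2"
        unfolding norm_ell2 coord_minus Y using \<open>0 < r\<close> by (intro real_le_lsqrt) auto
      then show ?thesis
        using \<open>0 < r\<close> by (simp add: dist_norm)
    qed
    then show "\<exists>M. \<forall>n\<ge>M. dist (X n) (Abs_ell2 g) < r"
      by blast
  qed
  then show "convergent X"
    by (rule convergentI)
qed

instance ell2 :: (type) banach ..

lemma norm_cscale: "norm (c *\<^sub>C x) = cmod c * norm x"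
  by (simp add: norm_ell2 cscale.rep_eq norm_mult power_mult_distrib infsum_cmult_right'
      real_sqrt_mult)

lemma bounded_linear_cscale: "bounded_linear (\<lambda>x. c *\<^sub>C x)"
  by (rule bounded_linear_intro [where K = "cmod c"])
    (auto simp: coord_inject_ext cscale.rep_eq plus_ell2.rep_eq scaleR_ell2_def algebra_simps
      norm_cscale)


section \<open>Operator algebras on \<open>\<ell>\<^sup>2\<close>\<close>

text \<open>The type \<open>'a ell2 \<Rightarrow>\<^sub>L 'a ell2\<close> consists of the bounded \<^emph>\<open>real\<close>-linear maps; the bounded
  operators in the usual sense are singled out by \<open>clinear_op\<close>.\<close>

type_synonym 'a op = "'a ell2 \<Rightarrow>\<^sub>L 'a ell2"

definition clinear_op :: "'a op \<Rightarrow> bool" where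
  "clinear_op T \<longleftrightarrow> (\<forall>c x. T (c *\<^sub>C x) = c *\<^sub>C T x)"

definition scale_op :: "complex \<Rightarrow> 'a op \<Rightarrow> 'a op" where
  "scale_op c T = Blinfun (\<lambda>x. c *\<^sub>C T x)"

lemma scale_op_apply: "scale_op c T x = c *\<^sub>C T x"
  unfolding scale_op_def
  by (subst bounded_linear_Blinfun_apply)
    (auto intro: bounded_linear_compose [OF bounded_linear_cscale] blinfun.bounded_linear_right)

definition is_adjoint :: "'a op \<Rightarrow> 'a op \<Rightarrow> bool" where
  "is_adjoint T B \<longleftrightarrow> (\<forall>x y. cinner (T x) y = cinner x (B y))"

definition unital_cstar_algebra :: "'a op set \<Rightarrow> bool" where
  "unital_cstar_algebra A \<longleftrightarrow>
     (\<forall>T\<in>A. clinear_op T) \<and>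
     id_blinfun \<in> A \<and>
     (\<forall>S\<in>A. \<forall>T\<in>A. S + T \<in> A) \<and>
     (\<forall>c. \<forall>T\<in>A. scale_op c T \<in> A) \<and>
     (\<forall>S\<in>A. \<forall>T\<in>A. S o\<^sub>L T \<in> A) \<and>
     (\<forall>T\<in>A. \<exists>B\<in>A. is_adjoint T B) \<and>
     closed A"

definition cstar_generated :: "'a op set \<Rightarrow> 'a op set" where
  "cstar_generated G = \<Inter>{A. unital_cstar_algebra A \<and> G \<subseteq> A}"


section \<open>Gelfand spectrum and spectral measures\<close>

text \<open>Characters are made \<open>extensional\<close>, i.e.\ constant outside \<open>A\<close>, so that they correspond
  bijectively to functionals on \<open>A\<close>.\<close>

definition gelfand_spectrum :: "'a op set \<Rightarrow> ('a op \<Rightarrow> complex) set" where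
  "gelfand_spectrum A = {\<phi> \<in> extensional A.
     (\<forall>S\<in>A. \<forall>T\<in>A. \<phi> (S + T) = \<phi> S + \<phi> T) \<and>
     (\<forall>c. \<forall>T\<in>A. \<phi> (scale_op c T) = c * \<phi> T) \<and>
     (\<forall>S\<in>A. \<forall>T\<in>A. \<phi> (S o\<^sub>L T) = \<phi> S * \<phi> T) \<and>
     (\<exists>T\<in>A. \<phi> T \<noteq> 0)}"

text \<open>The weak-* topology is the topology of pointwise convergence on \<open>A\<close>.\<close>

definition weak_star_topology :: "'a op set \<Rightarrow> ('a op \<Rightarrow> complex) topology" where
  "weak_star_topology A =
     subtopology (product_topology (\<lambda>_. euclidean) A) (gelfand_spectrum A)"

definition gelfand_inverse :: "'a op set \<Rightarrow> (('a op \<Rightarrow> complex) \<Rightarrow> complex) \<Rightarrow> 'a op" where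
  "gelfand_inverse A f = (THE T. T \<in> A \<and> (\<forall>\<phi>\<in>gelfand_spectrum A. \<phi> T = f \<phi>))"

definition radon_measure :: "'b topology \<Rightarrow> 'b measure \<Rightarrow> bool" where
  "radon_measure X \<mu> \<longleftrightarrow>
     space \<mu> = topspace X \<and>
     sets \<mu> = sigma_sets (topspace X) {U. openin X U} \<and>
     (\<forall>K. compactin X K \<longrightarrow> emeasure \<mu> K < \<infinity>) \<and>
     (\<forall>B\<in>sets \<mu>. emeasure \<mu> B = (SUP K\<in>{K. compactin X K \<and> K \<subseteq> B}. emeasure \<mu> K))"

text \<open>The diagonal spectral measure \<open>\<nu>\<^bsub>x,x\<^esub>\<close>, which is a positive measure.\<close>

definition spectral_measure :: "'a op set \<Rightarrow> 'a ell2 \<Rightarrow> ('a op \<Rightarrow> complex) measure" where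
  "spectral_measure A x = (THE \<mu>. radon_measure (weak_star_topology A) \<mu> \<and>
     (\<forall>f. continuous_map (weak_star_topology A) euclidean f \<longrightarrow>
        has_bochner_integral \<mu> f (cinner (gelfand_inverse A f x) x)))"

definition locally_negligible :: "'b topology \<Rightarrow> 'b measure \<Rightarrow> 'b set \<Rightarrow> bool" where
  "locally_negligible X \<mu> N \<longleftrightarrow>
     (\<forall>K. compactin X K \<longrightarrow> (\<exists>B\<in>null_sets \<mu>. N \<inter> K \<subseteq> B))"

definition basic_measure :: "'a op set \<Rightarrow> ('a op \<Rightarrow> complex) measure \<Rightarrow> bool" where
  "basic_measure A \<mu> \<longleftrightarrow>
     radon_measure (weak_star_topology A) \<mu> \<and>
     (\<forall>N \<subseteq> gelfand_spectrum A.
        locally_negligible (weak_star_topology A) \<mu> N \<longleftrightarrow>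
        (\<forall>x. locally_negligible (weak_star_topology A) (spectral_measure A x) N))"


section \<open>The discrete monotone Fock space\<close>

text \<open>All strictly increasing finite sequences of positive integers, the empty one included:
  \<open>mono_seq\<close> is the disjoint union of the sets \<open>I\<^sub>k\<close> and of a point indexing the vacuum, whence
  \<open>\<Oplus>\<^sub>k \<H>\<^sub>k = \<ell>\<^sup>2(mono_seq)\<close>.\<close>

typedef mono_seq = "{is :: nat list. sorted_wrt (<) is \<and> 0 \<notin> set is}"
  by (rule exI [of _ "[]"]) simp

type_synonym fock = "mono_seq ell2"

definition vacuum :: fock where
  "vacuum = ket (Abs_mono_seq [])"

definition prependable :: "nat \<Rightarrow> mono_seq \<Rightarrow> bool" where
  "prependable i J \<longleftrightarrow> 1 \<le> i \<and> (Rep_mono_seq J = [] \<or> i < hd (Rep_mono_seq J))"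

definition prepend :: "nat \<Rightarrow> mono_seq \<Rightarrow> mono_seq" where
  "prepend i J = Abs_mono_seq (i # Rep_mono_seq J)"

definition starts_with :: "nat \<Rightarrow> mono_seq \<Rightarrow> bool" where
  "starts_with i J \<longleftrightarrow> Rep_mono_seq J \<noteq> [] \<and> hd (Rep_mono_seq J) = i"

definition tail :: "mono_seq \<Rightarrow> mono_seq" where
  "tail J = Abs_mono_seq (tl (Rep_mono_seq J))"

lemma Rep_prepend: "prependable i J \<Longrightarrow> Rep_mono_seq (prepend i J) = i # Rep_mono_seq J"
  unfolding prepend_def prependable_def
  using Rep_mono_seq [of J]
  by (intro Abs_mono_seq_inverse) (cases "Rep_mono_seq J"; auto)

lemma Rep_tail: "Rep_mono_seq (tail J) = tl (Rep_mono_seq J)"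
  unfolding tail_def using Rep_mono_seq [of J]
  by (intro Abs_mono_seq_inverse) (cases "Rep_mono_seq J"; auto)

lemma tail_prepend: "prependable i J \<Longrightarrow> tail (prepend i J) = J"
  by (simp add: Rep_mono_seq_inject [symmetric] Rep_tail Rep_prepend)

lemma starts_with_prepend: "prependable i J \<Longrightarrow> starts_with i (prepend i J)"
  by (simp add: starts_with_def Rep_prepend)

lemma prependable_tail: "starts_with i J \<Longrightarrow> prependable i (tail J)"
  unfolding prependable_def starts_with_def Rep_tail
  using Rep_mono_seq [of J]
  by (cases "Rep_mono_seq J" rule: remdups_adj.cases) (auto simp: Suc_le_eq)

lemma prepend_tail:
  assumes "starts_with i J" shows "prepend i (tail J) = J"
  using Rep_prepend [OF prependable_tail [OF assms]] assms
  by (cases "Rep_mono_seq J")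
    (simp_all add: Rep_mono_seq_inject [symmetric] Rep_tail starts_with_def)

lemma inj_on_tail: "inj_on tail {J. starts_with i J}"
  by (rule inj_onI) (metis mem_Collect_eq prepend_tail)

lemma inj_on_prepend: "inj_on (prepend i) {J. prependable i J}"
  by (rule inj_onI) (metis mem_Collect_eq tail_prepend)

lemma sq_summable_pullback:
  fixes f :: "'a \<Rightarrow> complex"
  assumes f: "(\<lambda>i. (cmod (f i))\<^sup>2) summable_on UNIV" and g: "inj_on g {j. P j}"
  shows "(\<lambda>j. (cmod (if P j then f (g j) else 0))\<^sup>2) summable_on UNIV"
    and "(\<Sum>\<^sub>\<infinity>j. (cmod (if P j then f (g j) else 0))\<^sup>2) \<le> (\<Sum>\<^sub>\<infinity>i. (cmod (f i))\<^sup>2)"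
proof -
  let ?h = "\<lambda>i. (cmod (f i))\<^sup>2"
  let ?D = "{j. P j}"
  have s: "?h summable_on g ` ?D"
    by (rule summable_on_subset_banach [OF f]) simp
  then have "(?h \<circ> g) summable_on ?D"
    using summable_on_reindex [OF g] by blast
  then show "(\<lambda>j. (cmod (if P j then f (g j) else 0))\<^sup>2) summable_on UNIV"
    by (subst summable_on_cong_neutral [where T = ?D and g = "?h \<circ> g"]) auto
  have "(\<Sum>\<^sub>\<infinity>j. (cmod (if P j then f (g j) else 0))\<^sup>2) = infsum (?h \<circ> g) ?D"
    by (rule infsum_cong_neutral) auto
  also have "\<dots> = infsum ?h (g ` ?D)"
    using infsum_reindex [OF g] by metis
  also have "\<dots> \<le> infsum ?h UNIV"
    by (rule infsum_mono2) (auto intro: s f)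
  finally show "(\<Sum>\<^sub>\<infinity>j. (cmod (if P j then f (g j) else 0))\<^sup>2) \<le> infsum ?h UNIV" .
qed

lift_definition creation_map :: "nat \<Rightarrow> fock \<Rightarrow> fock"
  is "\<lambda>i f J. if starts_with i J then f (tail J) else 0"
  by (rule sq_summable_pullback(1) [OF _ inj_on_tail])

lift_definition annihilation_map :: "nat \<Rightarrow> fock \<Rightarrow> fock"
  is "\<lambda>i f J. if prependable i J then f (prepend i J) else 0"
  by (rule sq_summable_pullback(1) [OF _ inj_on_prepend])

lemma bounded_linear_creation_map: "bounded_linear (creation_map i)"
proof (rule bounded_linear_intro [where K = 1])
  fix x y :: fock and r :: real
  show "creation_map i (x + y) = creation_map i x + creation_map i y"
    "creation_map i (r *\<^sub>R x) = r *\<^sub>R creation_map i x"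
    by (simp_all add: coord_inject_ext creation_map.rep_eq plus_ell2.rep_eq scaleR_ell2_def
        cscale.rep_eq)
  show "norm (creation_map i x) \<le> norm x * 1"
    using sq_summable_pullback(2) [OF sq_summable_coord [of x] inj_on_tail [of i]]
    by (simp add: norm_ell2 creation_map.rep_eq)
qed

definition creation :: "nat \<Rightarrow> mono_seq op" where
  "creation i = Blinfun (creation_map i)"

lemma creation_apply: "blinfun_apply (creation i) = creation_map i"
  by (simp add: creation_def bounded_linear_Blinfun_apply bounded_linear_creation_map)

lemma bounded_linear_annihilation_map: "bounded_linear (annihilation_map i)"
proof (rule bounded_linear_intro [where K = 1])
  fix x y :: fock and r :: real
  show "annihilation_map i (x + y) = annihilation_map i x + annihilation_map i y"
    "annihilation_map i (r *\<^sub>R x) = r *\<^sub>R annihilation_map i x"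
    by (simp_all add: coord_inject_ext annihilation_map.rep_eq plus_ell2.rep_eq scaleR_ell2_def
        cscale.rep_eq)
  show "norm (annihilation_map i x) \<le> norm x * 1"
    using sq_summable_pullback(2) [OF sq_summable_coord [of x] inj_on_prepend [of i]]
    by (simp add: norm_ell2 annihilation_map.rep_eq)
qed

definition annihilation :: "nat \<Rightarrow> mono_seq op" where
  "annihilation i = Blinfun (annihilation_map i)"

lemma annihilation_apply: "blinfun_apply (annihilation i) = annihilation_map i"
  by (simp add: annihilation_def bounded_linear_Blinfun_apply bounded_linear_annihilation_map)

text \<open>The creation and annihilation operators, given above in coordinates, are complex-linear,
  act on the canonical basis in the prescribed way, and are mutually adjoint.\<close>

lemma clinear_creation: "clinear_op (creation i)"
  by (simp add: clinear_op_def creation_apply coord_inject_ext creation_map.rep_eq cscale.rep_eq)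

lemma clinear_annihilation: "clinear_op (annihilation i)"
  by (simp add: clinear_op_def annihilation_apply coord_inject_ext annihilation_map.rep_eq
      cscale.rep_eq)

lemma creation_ket: "creation i (ket J) = (if prependable i J then ket (prepend i J) else 0)"
  by (auto simp: creation_apply coord_inject_ext creation_map.rep_eq ket.rep_eq zero_ell2.rep_eq
      tail_prepend starts_with_prepend prependable_tail prepend_tail)

lemma annihilation_ket: "annihilation i (ket J) = (if starts_with i J then ket (tail J) else 0)"
  by (auto simp: annihilation_apply coord_inject_ext annihilation_map.rep_eq ket.rep_eq
      zero_ell2.rep_eq tail_prepend starts_with_prepend prependable_tail prepend_tail)

lemma creation_vacuum: "1 \<le> i \<Longrightarrow> creation i vacuum = ket (Abs_mono_seq [i])"
  by (simp add: vacuum_def creation_ket prependable_def prepend_def Abs_mono_seq_inverse)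

lemma annihilation_vacuum: "annihilation i vacuum = 0"
  by (simp add: vacuum_def annihilation_ket starts_with_def Abs_mono_seq_inverse)

lemma is_adjoint_creation: "is_adjoint (creation i) (annihilation i)"
  unfolding is_adjoint_def
proof (intro allI)
  fix x y :: fock
  let ?S = "{J. starts_with i J}" and ?P = "{J. prependable i J}"
  have "cinner (creation i x) y = (\<Sum>\<^sub>\<infinity>J\<in>?S. coord x (tail J) * cnj (coord y J))"
    unfolding cinner_def creation_apply creation_map.rep_eq
    by (rule infsum_cong_neutral) auto
  also have "\<dots> = (\<Sum>\<^sub>\<infinity>J\<in>?P. coord x J * cnj (coord y (prepend i J)))"
    by (rule infsum_reindex_bij_witness [of _ "prepend i" tail])
      (auto simp: tail_prepend starts_with_prepend prependable_tail prepend_tail)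
  also have "\<dots> = cinner x (annihilation i y)"
    unfolding cinner_def annihilation_apply annihilation_map.rep_eq
    by (rule infsum_cong_neutral) auto
  finally show "cinner (creation i x) y = cinner x (annihilation i y)" .
qed

definition position :: "nat \<Rightarrow> mono_seq op" where
  "position i = annihilation i + creation i"

definition position_sum :: "nat \<Rightarrow> mono_seq op" where
  "position_sum n = (\<Sum>i=1..n. position i)"

definition position_algebra :: "nat \<Rightarrow> mono_seq op set" where
  "position_algebra n = cstar_generated {position_sum n}"

end

theory Submission
  imports Defs "HOL-Computational_Algebra.Polynomial"
begin

text \<open>The operator \<open>S\<^sub>n\<close> adds or removes entries \<open>\<le> n\<close> at the front of an increasing sequence and never
  touches the entries \<open>> n\<close>. So the Fock space splits into invariant subspaces, one for each finite set
  \<open>K\<close> of entries \<open>> n\<close>. On each of them the basis is indexed by the \<open>2\<^sup>n\<close> subsets \<open>J\<close> of \<open>{1..n}\<close>, and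
  \<open>S\<^sub>n\<close> is the adjacency matrix of the tree in which the parent of \<open>J \<noteq> {}\<close> is \<open>J\<close> without its minimum.

  The eigenvectors of this tree are explicit. Put \<open>r\<^sub>0 = l\<close> and \<open>r\<^sub>k\<^sub>+\<^sub>1 = r\<^sub>k - 1 / r\<^sub>k\<close>, so that
  \<open>r\<^sub>k = l - (1 / r\<^sub>0 + \<dots> + 1 / r\<^sub>k\<^sub>-\<^sub>1)\<close>, and give \<open>J\<close> the weight \<open>w J = (\<Prod>i\<in>J. 1 / r\<^sub>i\<^sub>-\<^sub>1)\<close>. At a vertex \<open>J\<close> with
  minimum \<open>m\<close> the children contribute \<open>(1 / r\<^sub>0 + \<dots> + 1 / r\<^sub>m\<^sub>-\<^sub>2) * w J\<close> and the parent contributes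
  \<open>r\<^sub>m\<^sub>-\<^sub>1 * w J\<close>, which add up to \<open>l * w J\<close>. The root has no parent, and the sum over all its children is \<open>l\<close>
  exactly if \<open>r\<^sub>n = 0\<close>. Every equation \<open>y - 1 / y = c\<close> has two distinct real solutions, neither of them
  \<open>0\<close>, so \<open>r\<^sub>n = 0\<close> has \<open>2\<^sup>n\<close> real solutions \<open>l\<close>
  (\<open>card_orbit_preimage\<close>, \<open>position_sum_eigvec\<close>).

  These eigenvectors are orthogonal, and they are as many as the dimension, so they span each invariant
  subspace (\<open>ket_in_span_eigvec\<close>). Therefore \<open>S\<^sub>n\<close> is a root of the product of the linear factors
  \<open>x - l\<close> (\<open>op_poly_position_sum_eq_0\<close>), and the algebra of \<open>S\<^sub>n\<close> consists of the polynomials in \<open>S\<^sub>n\<close>. Its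
  spectrum is the finite discrete set of these \<open>l\<close>, and \<open>\<nu>\<^bsub>x,x\<^esub>\<close> has mass \<open>\<parallel>P\<^sub>l x\<parallel>\<^sup>2\<close> at \<open>l\<close>, where \<open>P\<^sub>l\<close> is the
  spectral projection (\<open>spectral_measure_eq\<close>). For \<open>K = {}\<close> the eigenvector has coordinate \<open>w {} = 1\<close> at
  \<open>\<Omega>\<close>, so it is not orthogonal to \<open>\<Omega>\<close> and \<open>P\<^sub>l \<Omega> \<noteq> 0\<close> for all \<open>l\<close>. So the only
  \<open>\<nu>\<^bsub>\<Omega>,\<Omega>\<^esub>\<close>-negligible set is the empty one, and it is also the only set that is negligible for all
  \<open>\<nu>\<^bsub>x,x\<^esub>\<close>.\<close>


section \<open>Polynomials in an operator\<close>

lemma cscale_simps: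
  "c *\<^sub>C (x + y) = c *\<^sub>C x + c *\<^sub>C y" "(c + d) *\<^sub>C x = c *\<^sub>C x + d *\<^sub>C x"
  "c *\<^sub>C d *\<^sub>C x = (c * d) *\<^sub>C x" "1 *\<^sub>C x = x" "0 *\<^sub>C x = 0" "c *\<^sub>C (0 :: 'a ell2) = 0"
  by (auto simp: coord_inject_ext cscale.rep_eq plus_ell2.rep_eq zero_ell2.rep_eq algebra_simps)

lemma cinner_add_left: "cinner (x + y) z = cinner x z + cinner y z"
  unfolding cinner_def infsum_add [OF cinner_summable cinner_summable, symmetric]
  by (simp add: plus_ell2.rep_eq distrib_right)

lemma cinner_commute: "cinner y x = cnj (cinner x y)"
  unfolding cinner_def infsum_cnj [symmetric] by (simp add: mult.commute)

lemma cinner_add_right: "cinner x (y + z) = cinner x y + cinner x z"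
  by (metis cinner_add_left cinner_commute complex_cnj_add)

lemma cinner_cscale_left: "cinner (c *\<^sub>C x) y = c * cinner x y"
  unfolding cinner_def by (simp add: cscale.rep_eq mult.assoc infsum_cmult_right')

lemma cinner_cscale_right: "cinner x (c *\<^sub>C y) = cnj c * cinner x y"
  by (metis cinner_cscale_left cinner_commute complex_cnj_mult)

lemma cinner_zero [simp]: "cinner 0 x = 0" "cinner x 0 = 0"
  by (simp_all add: cinner_def zero_ell2.rep_eq)

lemma cinner_sum_left: "cinner (\<Sum>i\<in>I. f i) y = (\<Sum>i\<in>I. cinner (f i) y)"
  by (induction I rule: infinite_finite_induct) (auto simp: cinner_add_left)

lemma cinner_ket: "cinner x (ket a) = coord x a"
proof -
  have "cinner x (ket a) = (\<Sum>\<^sub>\<infinity>i\<in>{a}. coord x i)"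
    unfolding cinner_def by (rule infsum_cong_neutral) (auto simp: ket.rep_eq)
  then show ?thesis
    by simp
qed

lemma cinner_self: "cinner x x = complex_of_real ((norm x)\<^sup>2)"
proof -
  have "cinner x x = complex_of_real (Re (cinner x x))"
    using cinner_commute [of x x] by (simp add: complex_eq_iff)
  then show ?thesis
    by (metis inner_ell2_def power2_norm_eq_inner)
qed

lemma cinner_bound: "cmod (cinner x y) \<le> norm x * norm y"
proof (cases "cinner x y = 0")
  case False
  \<comment> \<open>A rotation makes the inner product a nonnegative number, hence equal to the real inner product.\<close>
  define u where "u = cnj (cinner x y) / cmod (cinner x y)"
  have u: "cmod u = 1" "u * cinner x y = cmod (cinner x y)"
    using False by (auto simp: u_def norm_divide complex_norm_square [symmetric]
        power2_eq_square field_simps)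
  have "cmod (cinner x y) = inner (u *\<^sub>C x) y"
    by (simp add: inner_ell2_def cinner_cscale_left u)
  also have "\<dots> \<le> norm (u *\<^sub>C x) * norm y"
    by (rule norm_cauchy_schwarz)
  finally show ?thesis
    by (simp add: norm_cscale u)
qed simp

lemma bounded_linear_cinner_left: "bounded_linear (\<lambda>x. cinner x y)"
  by (rule bounded_linear_intro [where K = "norm y"])
    (auto simp: cinner_add_left scaleR_ell2_def cinner_cscale_left cinner_bound
      scaleR_conv_of_real)

lemma scale_op_simps:
  "scale_op (a + b) T = scale_op a T + scale_op b T"
  "scale_op a (scale_op b T) = scale_op (a * b) T"
  "scale_op 0 T = 0" "scale_op 1 T = T"
  by (auto intro!: blinfun_eqI simp: scale_op_apply blinfun.add_left cscale_simps)

lemma bounded_bilinear_cscale: "bounded_bilinear (\<lambda>c (x :: 'a ell2). c *\<^sub>C x)"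
proof
  fix r :: real and c d :: complex and x y :: "'a ell2"
  show "(r *\<^sub>R c) *\<^sub>C x = r *\<^sub>R (c *\<^sub>C x)" "c *\<^sub>C (r *\<^sub>R x) = r *\<^sub>R (c *\<^sub>C x)"
    by (simp_all add: scaleR_ell2_def cscale_simps scaleR_conv_of_real mult.commute)
  show "\<exists>K. \<forall>a (b :: 'a ell2). norm (a *\<^sub>C b) \<le> norm a * norm b * K"
    by (rule exI [of _ 1]) (simp add: norm_cscale)
qed (simp_all add: cscale_simps)

text \<open>The Horner scheme, so that properties follow by induction on the polynomial as for \<open>poly\<close>.\<close>

definition op_poly :: "'a op \<Rightarrow> complex poly \<Rightarrow> 'a op" where
  "op_poly S p = fold_coeffs (\<lambda>a T. scale_op a id_blinfun + (S o\<^sub>L T)) p 0"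

lemma op_poly_0 [simp]: "op_poly S 0 = 0"
  by (simp add: op_poly_def)

lemma op_poly_pCons:
  "op_poly S (pCons a p) = scale_op a id_blinfun + (S o\<^sub>L op_poly S p)"
  by (cases "p = 0 \<and> a = 0") (auto simp: op_poly_def scale_op_simps)

lemma op_poly_1: "op_poly S 1 = id_blinfun"
  by (simp add: one_pCons op_poly_pCons scale_op_simps)

lemma op_poly_X: "op_poly S [:0, 1:] = S"
  by (auto intro!: blinfun_eqI simp: op_poly_pCons scale_op_simps blinfun.bilinear_simps)

lemma op_poly_add: "op_poly S (p + q) = op_poly S p + op_poly S q"
  by (induction p q rule: poly_induct2)
    (auto intro!: blinfun_eqI simp: op_poly_pCons scale_op_simps blinfun.bilinear_simps)

lemma op_poly_sum: "op_poly S (\<Sum>i\<in>I. p i) = (\<Sum>i\<in>I. op_poly S (p i))"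
  by (induction I rule: infinite_finite_induct) (auto simp: op_poly_add)

lemma op_poly_smult:
  assumes "clinear_op S"
  shows "op_poly S (smult c p) = scale_op c (op_poly S p)"
  using assms unfolding clinear_op_def
  by (induction p)
    (auto intro!: blinfun_eqI simp: op_poly_pCons scale_op_apply blinfun.bilinear_simps cscale_simps)

lemma op_poly_mult:
  assumes "clinear_op S"
  shows "op_poly S (p * q) = op_poly S p o\<^sub>L op_poly S q"
  by (induction p)
    (auto intro!: blinfun_eqI simp: op_poly_pCons op_poly_add op_poly_smult [OF assms]
      scale_op_apply blinfun.bilinear_simps cscale_simps)

lemma clinear_op_poly:
  assumes "clinear_op S"
  shows "clinear_op (op_poly S p)"
  using assms unfolding clinear_op_def
  by (induction p)
    (auto simp: op_poly_pCons scale_op_apply blinfun.bilinear_simps cscale_simps mult.commute)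

lemma op_poly_eigenvector:
  fixes S :: "'a op"
  assumes "S v = c *\<^sub>C v" and "clinear_op S"
  shows "op_poly S p v = poly p c *\<^sub>C v"
  using assms unfolding clinear_op_def
  by (induction p)
    (auto simp: op_poly_pCons scale_op_apply blinfun.bilinear_simps cscale_simps mult.commute)

lemma is_adjoint_op_poly:
  assumes "clinear_op S" and "is_adjoint S S"
  shows "is_adjoint (op_poly S p) (op_poly S (map_poly cnj p))"
proof (induction p)
  case 0
  then show ?case
    by (simp add: is_adjoint_def)
next
  case (pCons a p)
  \<comment> \<open>Taking adjoints reverses the two factors of \<open>S o\<^sub>L op_poly S p\<close>, which commute.\<close>
  have "S o\<^sub>L op_poly S q = op_poly S q o\<^sub>L S" for q
    using op_poly_mult [OF assms(1), of "[:0, 1:]" q] op_poly_mult [OF assms(1), of q "[:0, 1:]"]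
    by (simp add: op_poly_X mult.commute)
  then have "S (op_poly S q x) = op_poly S q (S x)" for q x
    by (metis blinfun_apply_blinfun_compose)
  then show ?case
    using pCons assms(2) unfolding is_adjoint_def
    by (simp add: map_poly_pCons op_poly_pCons blinfun.bilinear_simps scale_op_apply
        cinner_add_left cinner_add_right cinner_cscale_left cinner_cscale_right)
qed

lemma op_poly_in_algebra:
  assumes "unital_cstar_algebra A" and "S \<in> A"
  shows "op_poly S p \<in> A"
proof (induction p)
  case 0
  have "scale_op 0 S \<in> A"
    using assms unfolding unital_cstar_algebra_def by blast
  then show ?case
    by (simp add: scale_op_simps)
next
  case (pCons a p)
  with assms show ?case
    unfolding op_poly_pCons unital_cstar_algebra_def by blast
qed

text \<open>Hence a character of the polynomials in \<open>S\<close> is determined by its value at \<open>S\<close>, and this value is a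
  root of every polynomial that annihilates \<open>S\<close>.\<close>

lemma character_op_poly:
  assumes \<phi>: "\<phi> \<in> gelfand_spectrum A" and A: "unital_cstar_algebra A" "S \<in> A"
  shows "\<phi> (op_poly S p) = poly p (\<phi> S)"
proof -
  have add: "R \<in> A \<Longrightarrow> T \<in> A \<Longrightarrow> \<phi> (R + T) = \<phi> R + \<phi> T"
    and scale: "T \<in> A \<Longrightarrow> \<phi> (scale_op c T) = c * \<phi> T"
    and mult: "R \<in> A \<Longrightarrow> T \<in> A \<Longrightarrow> \<phi> (R o\<^sub>L T) = \<phi> R * \<phi> T" for R T c
    using \<phi> by (simp_all add: gelfand_spectrum_def)
  have mem: "id_blinfun \<in> A" "scale_op a id_blinfun \<in> A" "S o\<^sub>L op_poly S q \<in> A" "op_poly S q \<in> A"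
    for a q
    using A op_poly_in_algebra [OF A] by (simp_all add: unital_cstar_algebra_def)
  obtain T where T: "T \<in> A" "\<phi> T \<noteq> 0"
    using \<phi> by (auto simp: gelfand_spectrum_def)
  have "T o\<^sub>L id_blinfun = T"
    by (rule blinfun_eqI) simp
  then have one: "\<phi> id_blinfun = 1"
    using mult [OF T(1) mem(1)] T(2) by simp
  show ?thesis
  proof (induction p)
    case 0
    show ?case
      using scale [OF A(2), of 0] by (simp add: scale_op_simps)
  next
    case (pCons a p)
    then show ?case
      by (simp add: op_poly_pCons add scale mult mem A(2) one)
  qed
qed

lemma prod_linear_dvd:
  fixes q :: "complex poly"
  assumes "finite L" and "\<And>l. l \<in> L \<Longrightarrow> poly q l = 0"
  shows "(\<Prod>l\<in>L. [:- l, 1:]) dvd q"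
  using assms
proof (induction L)
  case (insert a L)
  then obtain k where k: "q = (\<Prod>l\<in>L. [:- l, 1:]) * k"
    by (auto elim: dvdE)
  have "poly (\<Prod>l\<in>L. [:- l, 1:]) a \<noteq> 0"
    using insert.hyps by (auto simp: poly_prod)
  then have "[:- a, 1:] dvd k"
    using insert.prems [of a] by (auto simp: k poly_eq_0_iff_dvd [symmetric])
  then show ?case
    unfolding k prod.insert [OF insert.hyps] by (subst mult.commute) (rule mult_dvd_mono, simp_all)
qed simp


section \<open>Radon measures on finite discrete spaces\<close>

lemma radon_measure_finite_discrete:
  assumes "finite U"
  shows "radon_measure (discrete_topology U) \<mu> \<longleftrightarrow> sets \<mu> = Pow U \<and> emeasure \<mu> U < \<infinity>"
proof -
  have sig: "sigma_sets U (Pow U) = Pow U"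
    using sigma_algebra.sigma_sets_eq [OF sigma_algebra_Pow] .
  have cpt: "compactin (discrete_topology U) K \<longleftrightarrow> K \<subseteq> U" for K
    using assms by (auto simp: compactin_discrete_topology intro: finite_subset)
  have open_Pow: "{V. openin (discrete_topology U) V} = Pow U"
    by auto
  show ?thesis
  proof
    assume "radon_measure (discrete_topology U) \<mu>"
    then show "sets \<mu> = Pow U \<and> emeasure \<mu> U < \<infinity>"
      unfolding radon_measure_def cpt open_Pow topspace_discrete_topology sig by blast
  next
    assume \<mu>: "sets \<mu> = Pow U \<and> emeasure \<mu> U < \<infinity>"
    then have "space \<mu> = U"
      using sets_eq_imp_space_eq [of \<mu> "count_space U"] by simp
    moreover have "emeasure \<mu> K < \<infinity>" if "K \<subseteq> U" for K
      using emeasure_mono [OF that, of \<mu>] \<mu> by (auto intro: le_less_trans)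
    moreover have "emeasure \<mu> B = (SUP K\<in>{K. K \<subseteq> U \<and> K \<subseteq> B}. emeasure \<mu> K)"
      if "B \<subseteq> U" for B
    proof (rule antisym)
      show "emeasure \<mu> B \<le> (SUP K\<in>{K. K \<subseteq> U \<and> K \<subseteq> B}. emeasure \<mu> K)"
        using that by (intro SUP_upper) simp
      show "(SUP K\<in>{K. K \<subseteq> U \<and> K \<subseteq> B}. emeasure \<mu> K) \<le> emeasure \<mu> B"
        using that \<mu> by (intro SUP_least emeasure_mono) simp_all
    qed
    ultimately show "radon_measure (discrete_topology U) \<mu>"
      using \<mu> unfolding radon_measure_def cpt open_Pow topspace_discrete_topology sig by simp
  qed
qed

text \<open>On a finite discrete space the indicators of points are continuous test functions, so the
  integrals determine the measure.\<close>

lemma radon_measure_finite_discrete_unique: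
  fixes I :: "('b \<Rightarrow> complex) \<Rightarrow> complex"
  assumes "finite U"
    and "radon_measure (discrete_topology U) \<mu>" "radon_measure (discrete_topology U) \<nu>"
    and int: "\<And>f. has_bochner_integral \<mu> f (I f)" "\<And>f. has_bochner_integral \<nu> f (I f)"
  shows "\<mu> = \<nu>"
proof -
  have sets: "sets \<mu> = Pow U" "sets \<nu> = Pow U" and fin: "emeasure \<mu> U < \<infinity>" "emeasure \<nu> U < \<infinity>"
    using assms by (auto simp: radon_measure_finite_discrete)
  have mass: "emeasure \<kappa> {a} = ennreal (Re (I (\<lambda>x. indicator {a} x *\<^sub>R 1)))"
    if "a \<in> U" "sets \<kappa> = Pow U" "emeasure \<kappa> U < \<infinity>" "\<And>f. has_bochner_integral \<kappa> f (I f)"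
    for \<kappa> a
  proof -
    have *: "emeasure \<kappa> {a} < \<infinity>"
      using emeasure_mono [of "{a}" U \<kappa>] that by (auto intro: le_less_trans)
    have "has_bochner_integral \<kappa> (\<lambda>x. indicator {a} x *\<^sub>R (1 :: complex)) (measure \<kappa> {a} *\<^sub>R 1)"
      using that * by (intro has_bochner_integral_indicator) auto
    then have "I (\<lambda>x. indicator {a} x *\<^sub>R 1) = measure \<kappa> {a} *\<^sub>R 1"
      using that(4) has_bochner_integral_eq by blast
    moreover have "emeasure \<kappa> {a} = ennreal (measure \<kappa> {a})"
      using * by (intro emeasure_eq_ennreal_measure) simp
    ultimately show ?thesis
      by simp
  qed
  show ?thesis
  proof (rule measure_eqI_finite [OF sets \<open>finite U\<close>])
    show "emeasure \<mu> {a} = emeasure \<nu> {a}" if "a \<in> U" for a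
      using mass [OF that sets(1) fin(1) int(1)] mass [OF that sets(2) fin(2) int(2)] by simp
  qed
qed

lemma locally_negligible_finite_discrete:
  assumes "finite U" and "N \<subseteq> U"
  shows "locally_negligible (discrete_topology U) (point_measure U m) N \<longleftrightarrow> (\<forall>a\<in>N. m a = 0)"
proof
  have cpt: "compactin (discrete_topology U) N"
    using assms finite_subset [OF assms(2) assms(1)] by (simp add: compactin_discrete_topology)
  assume "locally_negligible (discrete_topology U) (point_measure U m) N"
  then obtain B where "B \<in> null_sets (point_measure U m)" "N \<inter> N \<subseteq> B"
    using cpt unfolding locally_negligible_def by metis
  then show "\<forall>a\<in>N. m a = 0"
    unfolding null_sets_point_measure_iff by blast
next
  assume "\<forall>a\<in>N. m a = 0"
  then have "N \<in> null_sets (point_measure U m)"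
    using assms unfolding null_sets_point_measure_iff by blast
  then show "locally_negligible (discrete_topology U) (point_measure U m) N"
    unfolding locally_negligible_def by (intro allI impI bexI [of _ N] Int_lower1)
qed


section \<open>Diagonalisable self-adjoint operators with finitely many eigenvalues\<close>

text \<open>The setting of a diagonalisable self-adjoint operator, with a vector \<open>\<omega>\<close> that has a component in
  every eigenspace: by self-adjointness the last assumption prevents the spectral projections from killing
  \<open>\<omega>\<close>. Scaling the eigenvectors to have overlap \<open>1\<close> with \<open>\<omega>\<close> makes
  \<open>T \<mapsto> \<langle>T (v l), \<omega>\<rangle>\<close> the evaluation of polynomials in \<open>S\<close> at \<open>l\<close>.\<close>

locale finite_spectrum =
  fixes S :: "'a op" and \<Lambda> :: "complex set" and v :: "complex \<Rightarrow> 'a ell2" and \<omega> :: "'a ell2"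
  assumes finite: "finite \<Lambda>"
    and real: "\<Lambda> \<subseteq> \<real>"
    and clinear: "clinear_op S"
    and selfadjoint: "is_adjoint S S"
    and annihilated: "op_poly S (\<Prod>l\<in>\<Lambda>. [:- l, 1:]) = 0"
    and eigenvector: "l \<in> \<Lambda> \<Longrightarrow> S (v l) = l *\<^sub>C v l"
    and overlap: "l \<in> \<Lambda> \<Longrightarrow> cinner (v l) \<omega> = 1"
begin

text \<open>All relations between polynomials in \<open>S\<close> reduce to relations between numbers, since polynomials that
  agree on \<open>\<Lambda>\<close> differ by a multiple of the annihilating polynomial.\<close>

lemma op_poly_cong:
  assumes "\<And>l. l \<in> \<Lambda> \<Longrightarrow> poly p l = poly q l"
  shows "op_poly S p = op_poly S q"
proof -
  have "(\<Prod>l\<in>\<Lambda>. [:- l, 1:]) dvd p - q"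
    using assms by (intro prod_linear_dvd finite) auto
  then obtain k where "p - q = (\<Prod>l\<in>\<Lambda>. [:- l, 1:]) * k"
    by (rule dvdE)
  then have "p = (\<Prod>l\<in>\<Lambda>. [:- l, 1:]) * k + q"
    by (simp add: algebra_simps)
  then show ?thesis
    by (simp add: op_poly_add op_poly_mult [OF clinear] annihilated)
qed

lemma eigenvalue_read_off:
  assumes "l \<in> \<Lambda>"
  shows "cinner (op_poly S p (v l)) \<omega> = poly p l"
  using op_poly_eigenvector [OF eigenvector [OF assms] clinear] overlap [OF assms]
  by (simp add: cinner_cscale_left)

definition lagrange :: "complex \<Rightarrow> complex poly" where
  "lagrange l = (\<Prod>m\<in>\<Lambda> - {l}. smult (1 / (l - m)) [:- m, 1:])"

lemma poly_lagrange:
  assumes "l \<in> \<Lambda>" "m \<in> \<Lambda>"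
  shows "poly (lagrange l) m = (if m = l then 1 else 0)"
proof (cases "m = l")
  case True
  have "(\<Prod>k\<in>\<Lambda> - {l}. poly (smult (1 / (l - k)) [:- k, 1:]) l) = (\<Prod>k\<in>\<Lambda> - {l}. 1)"
    by (rule prod.cong) (auto simp: field_simps)
  with True show ?thesis
    by (simp add: lagrange_def poly_prod)
next
  case False
  then have "poly (lagrange l) m = 0"
    unfolding lagrange_def poly_prod using finite assms by (auto intro!: bexI [of _ m])
  with False show ?thesis
    by simp
qed

lemma poly_interpolation:
  assumes "m \<in> \<Lambda>"
  shows "poly (\<Sum>l\<in>\<Lambda>. smult (f l) (lagrange l)) m = f m"
proof -
  have "poly (\<Sum>l\<in>\<Lambda>. smult (f l) (lagrange l)) m = (\<Sum>l\<in>\<Lambda>. if m = l then f l else 0)"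
    using assms by (auto simp: poly_sum poly_lagrange intro!: sum.cong)
  then show ?thesis
    using assms finite by simp
qed

definition proj :: "complex \<Rightarrow> 'a op" where
  "proj l = op_poly S (lagrange l)"

lemma proj_idem: "l \<in> \<Lambda> \<Longrightarrow> proj l o\<^sub>L proj l = proj l"
  unfolding proj_def op_poly_mult [OF clinear, symmetric]
  by (rule op_poly_cong) (simp add: poly_lagrange)

text \<open>The values of the Lagrange polynomial on the real set \<open>\<Lambda>\<close> are real, so conjugating its coefficients
  does not change the operator.\<close>

lemma proj_selfadjoint:
  assumes "l \<in> \<Lambda>"
  shows "is_adjoint (proj l) (proj l)"
proof -
  have "poly (map_poly cnj (lagrange l)) m = poly (lagrange l) m" if "m \<in> \<Lambda>" for m
  proof -
    have "cnj m = m"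
      using that real by (auto simp: Reals_cnj_iff)
    then show ?thesis
      using poly_lagrange [OF assms that] by (metis complex_cnj_one complex_cnj_zero poly_cnj)
  qed
  then have "op_poly S (map_poly cnj (lagrange l)) = proj l"
    unfolding proj_def by (rule op_poly_cong)
  then show ?thesis
    using is_adjoint_op_poly [OF clinear selfadjoint, of "lagrange l"] by (simp add: proj_def)
qed

lemma cinner_proj:
  assumes "l \<in> \<Lambda>"
  shows "cinner (proj l x) x = complex_of_real ((norm (proj l x))\<^sup>2)"
proof -
  have "cinner (proj l x) x = cinner (proj l (proj l x)) x"
    using proj_idem [OF assms] by (metis blinfun_apply_blinfun_compose)
  also have "\<dots> = cinner (proj l x) (proj l x)"
    using proj_selfadjoint [OF assms] unfolding is_adjoint_def by blast
  finally show ?thesis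
    by (simp add: cinner_self)
qed

lemma proj_nonzero:
  assumes "l \<in> \<Lambda>"
  shows "proj l \<omega> \<noteq> 0"
proof
  assume "proj l \<omega> = 0"
  have "1 = cinner (proj l (v l)) \<omega>"
    using eigenvalue_read_off [OF assms] poly_lagrange [OF assms assms] by (simp add: proj_def)
  also have "\<dots> = cinner (v l) (proj l \<omega>)"
    using proj_selfadjoint [OF assms] unfolding is_adjoint_def by blast
  finally show False
    using \<open>proj l \<omega> = 0\<close> by simp
qed

lemma op_poly_expand: "op_poly S p = (\<Sum>l\<in>\<Lambda>. scale_op (poly p l) (proj l))"
proof -
  have "op_poly S p = op_poly S (\<Sum>l\<in>\<Lambda>. smult (poly p l) (lagrange l))"
    by (rule op_poly_cong) (simp add: poly_interpolation)
  then show ?thesis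
    by (simp add: op_poly_sum op_poly_smult [OF clinear] proj_def)
qed

text \<open>The coefficients of \<open>T\<close> in its expansion by spectral projections can be read off by continuous
  functionals, which turns the span of the projections into the solution set of an equation between
  continuous functions of \<open>T\<close>. This is how the range is seen to be closed.\<close>

lemma range_op_poly_fixpoints:
  "range (op_poly S) = {T :: 'a op. T = (\<Sum>l\<in>\<Lambda>. scale_op (cinner (blinfun_apply T (v l)) \<omega>) (proj l))}"
proof (intro equalityI subsetI)
  fix T assume "T \<in> range (op_poly S)"
  then obtain p where T: "T = op_poly S p"
    by auto
  have "T = (\<Sum>l\<in>\<Lambda>. scale_op (cinner (blinfun_apply T (v l)) \<omega>) (proj l))"
    unfolding T op_poly_expand [of p, symmetric]
    by (subst op_poly_expand) (simp add: eigenvalue_read_off)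
  then show "T \<in> {T :: 'a op. T = (\<Sum>l\<in>\<Lambda>. scale_op (cinner (blinfun_apply T (v l)) \<omega>) (proj l))}"
    by simp
next
  fix T :: "'a op"
  assume "T \<in> {T :: 'a op. T = (\<Sum>l\<in>\<Lambda>. scale_op (cinner (blinfun_apply T (v l)) \<omega>) (proj l))}"
  then have "T = (\<Sum>l\<in>\<Lambda>. scale_op (cinner (blinfun_apply T (v l)) \<omega>) (proj l))"
    by blast
  also have "\<dots> = op_poly S (\<Sum>l\<in>\<Lambda>. smult (cinner (blinfun_apply T (v l)) \<omega>) (lagrange l))"
    by (simp add: op_poly_sum op_poly_smult [OF clinear] proj_def)
  finally show "T \<in> range (op_poly S)"
    by (metis rangeI)
qed

lemma closed_range_op_poly: "closed (range (op_poly S))"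
proof -
  have op_eq_iff: "T = R \<longleftrightarrow> (\<forall>x. T x = R x)" for T R :: "'a op"
    by (metis blinfun_eqI)
  \<comment> \<open>Equality of operators is tested pointwise, where both sides depend continuously on \<open>T\<close>.\<close>
  have "range (op_poly S) =
      (\<Inter>x. {T :: 'a op. T x = (\<Sum>l\<in>\<Lambda>. cinner (T (v l)) \<omega> *\<^sub>C proj l x)})"
    unfolding range_op_poly_fixpoints op_eq_iff blinfun.sum_left scale_op_apply by blast
  moreover have "closed {T :: 'a op. T x = (\<Sum>l\<in>\<Lambda>. cinner (T (v l)) \<omega> *\<^sub>C proj l x)}" for x
    by (intro closed_Collect_eq continuous_intros bounded_linear.continuous_on
        [OF bounded_linear_cinner_left] bounded_bilinear.continuous_on [OF bounded_bilinear_cscale])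
  ultimately show ?thesis
    by auto
qed

lemma unital_cstar_algebra_range: "unital_cstar_algebra (range (op_poly S))"
  unfolding unital_cstar_algebra_def
proof (intro conjI ballI allI)
  show "closed (range (op_poly S))"
    by (rule closed_range_op_poly)
  show "id_blinfun \<in> range (op_poly S)"
    by (metis op_poly_1 rangeI)
next
  fix T assume "T \<in> range (op_poly S)"
  then obtain p where T: "T = op_poly S p" by blast
  show "clinear_op T"
    by (simp add: T clinear_op_poly clinear)
  show "scale_op c T \<in> range (op_poly S)" for c
    by (metis T op_poly_smult [OF clinear] rangeI)
  show "\<exists>B\<in>range (op_poly S). is_adjoint T B"
    using T is_adjoint_op_poly [OF clinear selfadjoint] by blast
next
  fix R T assume "R \<in> range (op_poly S)" "T \<in> range (op_poly S)"
  then obtain p q where RT: "R = op_poly S p" "T = op_poly S q" by blast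
  show "R + T \<in> range (op_poly S)"
    by (metis RT op_poly_add rangeI)
  show "R o\<^sub>L T \<in> range (op_poly S)"
    by (metis RT op_poly_mult [OF clinear] rangeI)
qed

lemma S_in_range: "S \<in> range (op_poly S)"
  by (metis op_poly_X rangeI)

lemma cstar_generated_eq: "cstar_generated {S} = range (op_poly S)"
proof
  show "cstar_generated {S} \<subseteq> range (op_poly S)"
    unfolding cstar_generated_def using unital_cstar_algebra_range S_in_range by blast
  show "range (op_poly S) \<subseteq> cstar_generated {S}"
    unfolding cstar_generated_def using op_poly_in_algebra by fastforce
qed

definition character :: "complex \<Rightarrow> 'a op \<Rightarrow> complex" where
  "character l = restrict (\<lambda>T :: 'a op. cinner (T (v l)) \<omega>) (range (op_poly S))"

lemma character_apply: "l \<in> \<Lambda> \<Longrightarrow> character l (op_poly S p) = poly p l"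
  by (simp add: character_def eigenvalue_read_off)

lemma character_S: "l \<in> \<Lambda> \<Longrightarrow> character l S = l"
  using character_apply [of l "[:0, 1:]"] by (simp add: op_poly_X)

text \<open>The value of a character at \<open>S\<close> is a root of the annihilating polynomial, hence in \<open>\<Lambda>\<close>; conversely,
  the eigenvector for a point of \<open>\<Lambda>\<close> realises the evaluation at this point.\<close>

lemma gelfand_spectrum_eq: "gelfand_spectrum (range (op_poly S)) = character ` \<Lambda>"
proof (intro equalityI subsetI)
  fix \<phi> assume \<phi>: "\<phi> \<in> gelfand_spectrum (range (op_poly S))"
  note eval = character_op_poly [OF \<phi> unital_cstar_algebra_range S_in_range]
  have "poly (\<Prod>l\<in>\<Lambda>. [:- l, 1:]) (\<phi> S) = 0"
    using eval [of "\<Prod>l\<in>\<Lambda>. [:- l, 1:]"] eval [of 0] annihilated by simp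
  then have S: "\<phi> S \<in> \<Lambda>"
    using finite by (auto simp: poly_prod)
  have "\<phi> = character (\<phi> S)"
  proof (rule extensionalityI)
    show "\<phi> \<in> extensional (range (op_poly S))"
      using \<phi> by (simp add: gelfand_spectrum_def)
    show "character (\<phi> S) \<in> extensional (range (op_poly S))"
      by (simp add: character_def)
  qed (auto simp: eval character_apply S)
  then show "\<phi> \<in> character ` \<Lambda>"
    using S by blast
next
  fix \<phi> assume "\<phi> \<in> character ` \<Lambda>"
  then obtain l where l: "l \<in> \<Lambda>" and \<phi>: "\<phi> = character l"
    by blast
  have "\<exists>T\<in>range (op_poly S). \<phi> T \<noteq> 0"
    by (rule bexI [of _ "op_poly S 1"]) (simp_all add: \<phi> character_apply l)
  moreover have "\<phi> \<in> extensional (range (op_poly S))"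
    by (simp add: \<phi> character_def)
  ultimately show "\<phi> \<in> gelfand_spectrum (range (op_poly S))"
    unfolding gelfand_spectrum_def
    by (simp add: \<phi> character_apply l op_poly_add [symmetric] op_poly_mult [OF clinear, symmetric]
        op_poly_smult [OF clinear, symmetric] del: op_poly_0)
qed

lemma inj_on_character: "inj_on character \<Lambda>"
  by (rule inj_onI) (metis character_S)

lemma weak_star_topology_eq:
  "weak_star_topology (range (op_poly S)) = discrete_topology (character ` \<Lambda>)"
proof (rule finite_t1_space_imp_discrete_topology)
  show "topspace (weak_star_topology (range (op_poly S))) = character ` \<Lambda>"
    unfolding weak_star_topology_def gelfand_spectrum_eq
    by (auto simp: character_def)
  show "t1_space (weak_star_topology (range (op_poly S)))"
    unfolding weak_star_topology_def
    by (intro Hausdorff_imp_t1_space Hausdorff_space_subtopology)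
      (simp add: Hausdorff_space_product_topology)
qed (simp add: finite)

lemma gelfand_inverse_eq:
  "gelfand_inverse (range (op_poly S)) f = (\<Sum>l\<in>\<Lambda>. scale_op (f (character l)) (proj l))"
  unfolding gelfand_inverse_def gelfand_spectrum_eq
proof (rule the_equality)
  let ?p = "\<Sum>l\<in>\<Lambda>. smult (f (character l)) (lagrange l)"
  have "(\<Sum>l\<in>\<Lambda>. scale_op (f (character l)) (proj l)) = op_poly S ?p"
    by (simp add: op_poly_sum op_poly_smult [OF clinear] proj_def)
  moreover have "poly ?p l = f (character l)" if "l \<in> \<Lambda>" for l
    using that by (rule poly_interpolation)
  ultimately show "(\<Sum>l\<in>\<Lambda>. scale_op (f (character l)) (proj l)) \<in> range (op_poly S) \<and>
      (\<forall>\<phi>\<in>character ` \<Lambda>. \<phi> (\<Sum>l\<in>\<Lambda>. scale_op (f (character l)) (proj l)) = f \<phi>)"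
    by (auto simp: character_apply)
next
  fix T
  assume T: "T \<in> range (op_poly S) \<and> (\<forall>\<phi>\<in>character ` \<Lambda>. \<phi> T = f \<phi>)"
  then obtain p where p: "T = op_poly S p"
    by blast
  with T have "poly p l = f (character l)" if "l \<in> \<Lambda>" for l
    using that character_apply by auto
  then show "T = (\<Sum>l\<in>\<Lambda>. scale_op (f (character l)) (proj l))"
    unfolding p op_poly_expand by (intro sum.cong) auto
qed

definition mass :: "'a ell2 \<Rightarrow> ('a op \<Rightarrow> complex) \<Rightarrow> real" where
  "mass x \<phi> = (norm (proj (\<phi> S) x))\<^sup>2"

lemma radon_measure_mass:
  "radon_measure (discrete_topology (character ` \<Lambda>)) (point_measure (character ` \<Lambda>) (mass x))"
  by (simp add: radon_measure_finite_discrete finite sets_point_measure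
      emeasure_point_measure_finite mass_def)

text \<open>A function \<open>f\<close> on the spectrum has the Gelfand inverse \<open>\<Sum>l\<in>\<Lambda>. f l \<cdot> P\<^sub>l\<close>, and
  \<open>\<langle>P\<^sub>l x, x\<rangle> = \<parallel>P\<^sub>l x\<parallel>\<^sup>2\<close> because \<open>P\<^sub>l\<close> is an orthogonal projection.\<close>

lemma spectral_measure_eq:
  "spectral_measure (range (op_poly S)) x = point_measure (character ` \<Lambda>) (mass x)"
proof -
  let ?\<mu> = "point_measure (character ` \<Lambda>) (mass x)"
  let ?I = "\<lambda>f. cinner (gelfand_inverse (range (op_poly S)) f x) x"
  have nonneg: "0 \<le> mass x \<phi>" for \<phi>
    by (simp add: mass_def)
  have all_cont: "continuous_map (weak_star_topology (range (op_poly S))) euclidean f" for f :: "_ \<Rightarrow> complex"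
    by (simp add: weak_star_topology_eq)
  have int: "has_bochner_integral ?\<mu> f (?I f)" for f
  proof -
    have "?I f = (\<Sum>l\<in>\<Lambda>. f (character l) * cinner (proj l x) x)"
      by (simp add: gelfand_inverse_eq blinfun.sum_left scale_op_apply cinner_sum_left
          cinner_cscale_left)
    also have "\<dots> = (\<Sum>l\<in>\<Lambda>. mass x (character l) *\<^sub>R f (character l))"
      by (intro sum.cong)
        (simp_all add: cinner_proj mass_def character_S scaleR_conv_of_real mult.commute)
    also have "\<dots> = (\<Sum>\<phi>\<in>character ` \<Lambda>. mass x \<phi> *\<^sub>R f \<phi>)"
      by (simp add: sum.reindex [OF inj_on_character])
    also have "\<dots> = integral\<^sup>L ?\<mu> f"
      using finite nonneg by (simp add: lebesgue_integral_point_measure_finite)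
    finally show ?thesis
      using finite nonneg
      by (simp add: has_bochner_integral_iff integrable_point_measure_finite)
  qed
  show ?thesis
    unfolding spectral_measure_def
  proof (rule the_equality, goal_cases)
    case 1
    show ?case
      using int radon_measure_mass by (simp add: weak_star_topology_eq)
  next
    case (2 \<nu>)
    then show ?case
      using int radon_measure_mass finite all_cont
      by (intro radon_measure_finite_discrete_unique [where U = "character ` \<Lambda>" and I = ?I])
        (auto simp: weak_star_topology_eq)
  qed
qed

text \<open>No point of the spectrum is a null set for the spectral measure of \<open>\<omega>\<close>, so on both sides of the
  equivalence only the empty set is negligible.\<close>

theorem basic_measure_spectral_measure:
  "basic_measure (cstar_generated {S}) (spectral_measure (cstar_generated {S}) \<omega>)"
proof -
  have null_iff: "locally_negligible (discrete_topology (character ` \<Lambda>))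
      (point_measure (character ` \<Lambda>) (mass \<omega>)) N \<longleftrightarrow> N = {}"
    if "N \<subseteq> character ` \<Lambda>" for N
    using that proj_nonzero finite
    by (subst locally_negligible_finite_discrete) (force simp: mass_def character_S)+
  have "locally_negligible (discrete_topology (character ` \<Lambda>))
      (point_measure (character ` \<Lambda>) (mass \<omega>)) N \<longleftrightarrow>
      (\<forall>x. locally_negligible (discrete_topology (character ` \<Lambda>))
        (point_measure (character ` \<Lambda>) (mass x)) N)" if "N \<subseteq> character ` \<Lambda>" for N
    using that finite null_iff [OF that] by (auto simp: locally_negligible_finite_discrete)
  then show ?thesis
    unfolding basic_measure_def cstar_generated_eq spectral_measure_eq weak_star_topology_eq
      gelfand_spectrum_eq
    using radon_measure_mass by blast
qed

end



section \<open>The zeros of the iterates of \<open>y \<mapsto> y - 1 / y\<close>\<close>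

fun orbit :: "real \<Rightarrow> nat \<Rightarrow> real" where
  "orbit l 0 = l"
| "orbit l (Suc k) = orbit l k - 1 / orbit l k"

lemma orbit_telescope: "orbit l k = l - (\<Sum>j<k. 1 / orbit l j)"
  by (induction k) auto

text \<open>The preimages of \<open>c\<close> under \<open>y \<mapsto> y - 1 / y\<close> are the two distinct roots of \<open>y\<^sup>2 - c y - 1\<close>, whose
  product is \<open>-1\<close>; so each step back doubles the number of points. Orbits through \<open>0\<close> have to be excluded,
  because \<open>1 / 0 = 0\<close> would make \<open>0\<close> a fixed point.\<close>

lemma card_orbit_preimage:
  "finite {l. orbit l n = c \<and> (\<forall>k<n. orbit l k \<noteq> 0)} \<and>
   card {l. orbit l n = c \<and> (\<forall>k<n. orbit l k \<noteq> 0)} = 2 ^ n"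
proof (induction n arbitrary: c)
  case 0
  have "{l. l = c} = {c}"
    by auto
  then show ?case
    by simp
next
  case (Suc n)
  let ?Z = "\<lambda>n c. {l. orbit l n = c \<and> (\<forall>k<n. orbit l k \<noteq> 0)}"
  define d where "d = sqrt (c\<^sup>2 + 4)"
  define y z where "y = (c + d) / 2" and "z = (c - d) / 2"
  have d: "d\<^sup>2 = c\<^sup>2 + 4" "0 < d"
    by (auto simp: d_def add_nonneg_pos)
  have yz: "y \<noteq> z" "y * z = - 1" "y + z = c"
    using d by (auto simp: y_def z_def field_simps power2_eq_square)
  have roots: "x - 1 / x = c \<and> x \<noteq> 0 \<longleftrightarrow> x = y \<or> x = z" for x
  proof -
    have "(x - y) * (x - z) = x * x - (y + z) * x + y * z"
      by (simp add: algebra_simps)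
    then have "(x - y) * (x - z) = x * x - c * x - 1"
      by (simp add: yz)
    moreover have "x \<noteq> 0" if "x = y \<or> x = z"
      using that yz by auto
    moreover have "x - 1 / x = c \<longleftrightarrow> x * x - c * x - 1 = 0" if "x \<noteq> 0"
      using that by (auto simp: field_simps)
    ultimately show ?thesis
      by (metis mult_eq_0_iff right_minus_eq)
  qed
  have "?Z (Suc n) c = ?Z n y \<union> ?Z n z"
    using roots by (auto simp: less_Suc_eq)
  moreover have "?Z n y \<inter> ?Z n z = {}"
    using yz by auto
  ultimately show ?case
    using Suc [of y] Suc [of z] by (simp add: card_Un_disjoint)
qed

definition eigs :: "nat \<Rightarrow> real set" where
  "eigs n = {l. orbit l n = 0 \<and> (\<forall>k<n. orbit l k \<noteq> 0)}"

lemma finite_eigs: "finite (eigs n)" and card_eigs: "card (eigs n) = 2 ^ n"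
  unfolding eigs_def using card_orbit_preimage by blast+


section \<open>Eigenvectors of the position sum\<close>

definition low :: "nat \<Rightarrow> mono_seq \<Rightarrow> nat set" where
  "low n M = {i \<in> set (Rep_mono_seq M). i \<le> n}"

definition high :: "nat \<Rightarrow> mono_seq \<Rightarrow> nat set" where
  "high n M = {i \<in> set (Rep_mono_seq M). n < i}"

lemma mono_seq_eqI:
  assumes "low n M = low n N" "high n M = high n N"
  shows "M = N"
proof -
  have "set (Rep_mono_seq M) = low n M \<union> high n M" for M
    by (auto simp: low_def high_def)
  then have "set (Rep_mono_seq M) = set (Rep_mono_seq N)"
    using assms by metis
  then show ?thesis
    using Rep_mono_seq [of M] Rep_mono_seq [of N]
    by (auto intro: strict_sorted_equal simp: Rep_mono_seq_inject [symmetric])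
qed

text \<open>The subspaces with a prescribed set of entries \<open>> n\<close> have dimension at most \<open>2\<^sup>n\<close>, because a sequence
  is determined by its set of entries.\<close>

lemma finite_high_fiber: "finite {M. high n M = K}"
  and card_high_fiber: "card {M. high n M = K} \<le> 2 ^ n"
proof -
  have inj: "inj_on (low n) {M. high n M = K}"
    by (rule inj_onI) (auto intro: mono_seq_eqI)
  have sub: "low n ` {M. high n M = K} \<subseteq> Pow {1..n}"
  proof -
    have "low n M \<subseteq> {1..n}" for M
      using Rep_mono_seq [of M] by (auto simp: low_def Suc_le_eq intro!: gr0I)
    then show ?thesis
      by auto
  qed
  show "finite {M. high n M = K}"
    using inj_on_finite [OF inj sub] by simp
  show "card {M. high n M = K} \<le> 2 ^ n"
    using card_inj_on_le [OF inj sub] by (simp add: card_Pow)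
qed

text \<open>The tree eigenvector for \<open>l\<close> on the invariant subspace of the sequences whose entries \<open>> n\<close> form \<open>K\<close>.\<close>

lift_definition eigvec :: "nat \<Rightarrow> real \<Rightarrow> nat set \<Rightarrow> fock"
  is "\<lambda>n l K M. if high n M = K then complex_of_real (\<Prod>i\<in>low n M. 1 / orbit l (i - 1)) else 0"
proof -
  fix n :: nat and l :: real and K :: "nat set"
  show "(\<lambda>M. (cmod (if high n M = K then complex_of_real (\<Prod>i\<in>low n M. 1 / orbit l (i - 1))
      else 0))\<^sup>2) summable_on UNIV"
    by (rule finite_nonzero_values_imp_summable_on, rule finite_subset [OF _ finite_high_fiber [of n K]])
      (auto split: if_splits)
qed

lemma coord_sum: "coord (\<Sum>i\<in>I. f i) M = (\<Sum>i\<in>I. coord (f i) M)"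
  by (induction I rule: infinite_finite_induct) (auto simp: zero_ell2.rep_eq plus_ell2.rep_eq)

lemma coord_position_sum:
  "coord (position_sum n x) M =
     (\<Sum>i=1..n. if prependable i M then coord x (prepend i M) else 0) +
     (\<Sum>i=1..n. if starts_with i M then coord x (tail M) else 0)"
  by (simp add: position_sum_def position_def blinfun.sum_left blinfun.add_left coord_sum
      plus_ell2.rep_eq annihilation_apply creation_apply annihilation_map.rep_eq
      creation_map.rep_eq sum.distrib)

lemma low_high_prepend:
  assumes "prependable i M" and "i \<le> n"
  shows "low n (prepend i M) = insert i (low n M)" "i \<notin> low n M" "high n (prepend i M) = high n M"
proof -
  show "low n (prepend i M) = insert i (low n M)" "high n (prepend i M) = high n M"
    using assms by (auto simp: low_def high_def Rep_prepend)
  show "i \<notin> low n M"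
    using Rep_mono_seq [of "prepend i M"] assms by (auto simp: low_def Rep_prepend)
qed

lemma coord_eigvec_prepend:
  assumes "prependable i M" and "i \<le> n"
  shows "coord (eigvec n l K) (prepend i M) =
    complex_of_real (1 / orbit l (i - 1)) * coord (eigvec n l K) M"
  using low_high_prepend [OF assms] by (simp add: eigvec.rep_eq low_def)

text \<open>At a sequence that starts with \<open>m \<le> n\<close>, annihilation collects the extensions by \<open>i < m\<close>, which sum to
  \<open>l - orbit l (m - 1)\<close> times the coordinate, and creation restores the missing \<open>orbit l (m - 1)\<close>. At a
  sequence without entries \<open>\<le> n\<close> there is no creation term, and the \<open>n\<close> extensions sum to
  \<open>l - orbit l n = l\<close>.\<close>

lemma position_sum_eigvec:
  assumes "l \<in> eigs n"
  shows "position_sum n (eigvec n l K) = complex_of_real l *\<^sub>C eigvec n l K"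
  unfolding coord_inject_ext
proof
  fix M
  let ?w = "coord (eigvec n l K)"
  have reindex: "(\<Sum>i=1..m. complex_of_real (1 / orbit l (i - 1))) =
      complex_of_real (l - orbit l m)" for m
  proof -
    have "(\<Sum>i=1..m. 1 / orbit l (i - 1)) = (\<Sum>j<m. 1 / orbit l j)"
      by (rule sum.reindex_bij_witness [of _ Suc "\<lambda>i. i - 1"]) auto
    then have "(\<Sum>i=1..m. 1 / orbit l (i - 1)) = l - orbit l m"
      using orbit_telescope [of l m] by simp
    then show ?thesis
      unfolding of_real_sum [symmetric] by (rule arg_cong)
  qed
  have annih: "(\<Sum>i=1..n. if prependable i M then ?w (prepend i M) else 0) =
      complex_of_real (l - orbit l m) * ?w M"
    if "m \<le> n" "\<And>i. i \<in> {1..n} \<Longrightarrow> prependable i M \<longleftrightarrow> i \<le> m" for m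
  proof -
    have "(\<Sum>i=1..n. if prependable i M then ?w (prepend i M) else 0) =
        (\<Sum>i=1..m. complex_of_real (1 / orbit l (i - 1)) * ?w M)"
      using that
      by (intro sum.mono_neutral_cong_right) (auto simp: coord_eigvec_prepend)
    then show ?thesis
      unfolding sum_distrib_right [symmetric] reindex .
  qed
  have "coord (position_sum n (eigvec n l K)) M = complex_of_real l * ?w M"
  proof (cases "\<exists>m\<in>{1..n}. starts_with m M")
    case True
    then obtain m where m: "1 \<le> m" "m \<le> n" "starts_with m M"
      by auto
    have starts: "starts_with i M \<longleftrightarrow> i = m" for i
      using m by (auto simp: starts_with_def)
    have "(\<Sum>i=1..n. if prependable i M then ?w (prepend i M) else 0) =
        complex_of_real (l - orbit l (m - 1)) * ?w M"
      using m by (intro annih) (auto simp: prependable_def starts_with_def)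
    moreover have "(\<Sum>i=1..n. if starts_with i M then ?w (tail M) else 0) =
        complex_of_real (orbit l (m - 1)) * ?w M"
    proof -
      have "?w M = complex_of_real (1 / orbit l (m - 1)) * ?w (tail M)"
        using coord_eigvec_prepend [OF prependable_tail [OF m(3)] m(2)] prepend_tail [OF m(3)]
        by simp
      moreover have "orbit l (m - 1) \<noteq> 0"
        using assms m by (auto simp: eigs_def)
      ultimately show ?thesis
        using m by (simp add: starts)
    qed
    ultimately show ?thesis
      by (simp add: coord_position_sum algebra_simps)
  next
    case False
    have "(\<Sum>i=1..n. if prependable i M then ?w (prepend i M) else 0) =
        complex_of_real (l - orbit l n) * ?w M"
    proof (rule annih)
      have "hd (Rep_mono_seq M) \<notin> {1..n}" if "Rep_mono_seq M \<noteq> []"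
        using that False by (auto simp: starts_with_def)
      moreover have "hd (Rep_mono_seq M) \<noteq> 0" if "Rep_mono_seq M \<noteq> []"
        using Rep_mono_seq [of M] hd_in_set [OF that] by (metis (no_types, lifting) mem_Collect_eq)
      ultimately show "prependable i M \<longleftrightarrow> i \<le> n" if "i \<in> {1..n}" for i
        using that by (force simp: prependable_def)
    qed simp
    moreover have "(\<Sum>i=1..n. if starts_with i M then ?w (tail M) else 0) = 0"
      using False by (intro sum.neutral) auto
    moreover have "orbit l n = 0"
      using assms by (simp add: eigs_def)
    ultimately show ?thesis
      by (simp add: coord_position_sum)
  qed
  then show "coord (position_sum n (eigvec n l K)) M = coord (complex_of_real l *\<^sub>C eigvec n l K) M"
    by (simp add: cscale.rep_eq)
qed

lemma is_adjoint_position_sum: "is_adjoint (position_sum n) (position_sum n)"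
proof -
  have 1: "cinner (creation i x) y = cinner x (annihilation i y)" for i x y
    using is_adjoint_creation unfolding is_adjoint_def by blast
  have 2: "cinner (annihilation i x) y = cinner x (creation i y)" for i x y
    using 1 [of i y x] cinner_commute by metis
  have "cinner ((\<Sum>i\<in>I. position i) x) y = cinner x ((\<Sum>i\<in>I. position i) y)" for I x y
    by (induction I rule: infinite_finite_induct)
      (auto simp: blinfun.bilinear_simps position_def cinner_add_left cinner_add_right 1 2)
  then show ?thesis
    by (simp add: is_adjoint_def position_sum_def)
qed

lemma clinear_position_sum: "clinear_op (position_sum n)"
proof -
  have "(\<Sum>i\<in>I. position i) (c *\<^sub>C x) = c *\<^sub>C (\<Sum>i\<in>I. position i) x" for I c x
    using clinear_creation clinear_annihilation unfolding clinear_op_def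
    by (induction I rule: infinite_finite_induct)
      (auto simp: blinfun.bilinear_simps position_def cscale_simps)
  then show ?thesis
    by (simp add: clinear_op_def position_sum_def)
qed

lemma orthogonal_eigvec:
  assumes "l \<in> eigs n" "m \<in> eigs n" "l \<noteq> m"
  shows "orthogonal (eigvec n l K) (eigvec n m K)"
proof -
  have "cinner (position_sum n (eigvec n l K)) (eigvec n m K) =
      cinner (eigvec n l K) (position_sum n (eigvec n m K))"
    using is_adjoint_position_sum unfolding is_adjoint_def by blast
  then show ?thesis
    using assms
    by (simp add: position_sum_eigvec cinner_cscale_left cinner_cscale_right orthogonal_def
        inner_ell2_def)
qed

text \<open>The coordinate at the sequence without its entries \<open>\<le> n\<close> is an empty product.\<close>

lemma eigvec_high_nonzero: "eigvec n l (high n M) \<noteq> 0"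
proof -
  let ?N = "Abs_mono_seq (filter (\<lambda>i. n < i) (Rep_mono_seq M))"
  have "Rep_mono_seq ?N = filter (\<lambda>i. n < i) (Rep_mono_seq M)"
    using Rep_mono_seq [of M] by (intro Abs_mono_seq_inverse) (auto intro: sorted_wrt_filter)
  then have "high n ?N = high n M" "low n ?N = {}"
    by (auto simp: high_def low_def)
  then have "coord (eigvec n l (high n M)) ?N = 1"
    by (simp add: eigvec.rep_eq)
  then show ?thesis
    by (auto simp: zero_ell2.rep_eq)
qed

text \<open>A dimension count: the \<open>2\<^sup>n\<close> orthogonal eigenvectors lie in a space spanned by at most \<open>2\<^sup>n\<close> basis
  vectors, so another independent basis vector does not fit in. Real scalars suffice since the eigenvectors
  have real coordinates.\<close>

lemma ket_in_span_eigvec: "ket M \<in> span ((\<lambda>l. eigvec n l (high n M)) ` eigs n)"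
proof (rule ccontr)
  let ?K = "high n M" and ?W = "(\<lambda>l. eigvec n l (high n M)) ` eigs n"
  let ?B = "ket ` {N. high n N = high n M}"
  assume *: "ket M \<notin> span ?W"
  have inj: "inj_on (\<lambda>l. eigvec n l ?K) (eigs n)"
  proof (rule inj_onI, rule ccontr)
    fix l m
    assume "l \<in> eigs n" "m \<in> eigs n" "eigvec n l ?K = eigvec n m ?K" "l \<noteq> m"
    then have "orthogonal (eigvec n l ?K) (eigvec n l ?K)"
      using orthogonal_eigvec by metis
    then show False
      using eigvec_high_nonzero by (simp add: orthogonal_self)
  qed
  have "pairwise orthogonal ?W"
    by (rule pairwise_imageI) (rule orthogonal_eigvec)
  moreover have "0 \<notin> ?W"
    using eigvec_high_nonzero by (metis imageE)
  ultimately have "independent ?W"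
    by (rule pairwise_orthogonal_independent)
  then have indep: "independent (insert (ket M) ?W)"
    by (rule independent_insertI [OF *])
  have "eigvec n l ?K \<in> span ?B" for l
  proof -
    have expand: "eigvec n l ?K =
        (\<Sum>N\<in>{N. high n N = ?K}. (\<Prod>i\<in>low n N. 1 / orbit l (i - 1)) *\<^sub>R ket N)"
      unfolding coord_inject_ext coord_sum
    proof
      fix M'
      let ?c = "\<lambda>N. complex_of_real (\<Prod>i\<in>low n N. 1 / orbit l (i - 1))"
      have "(\<Sum>N\<in>{N. high n N = ?K}. coord ((\<Prod>i\<in>low n N. 1 / orbit l (i - 1)) *\<^sub>R ket N) M') =
          (\<Sum>N\<in>{N. high n N = ?K}. if M' = N then ?c N else 0)"
        by (rule sum.cong) (simp_all add: scaleR_ell2_def cscale.rep_eq ket.rep_eq)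
      then show "coord (eigvec n l ?K) M' =
          (\<Sum>N\<in>{N. high n N = ?K}. coord ((\<Prod>i\<in>low n N. 1 / orbit l (i - 1)) *\<^sub>R ket N) M')"
        using finite_high_fiber [of n ?K] by (simp add: eigvec.rep_eq)
    qed
    show ?thesis
      unfolding expand by (rule span_sum, rule span_scale, rule span_base, rule imageI)
  qed
  moreover have "ket M \<in> span ?B"
    by (rule span_base) simp
  ultimately have sub: "insert (ket M) ?W \<subseteq> span ?B"
    by blast
  have "card (insert (ket M) ?W) \<le> card ?B"
    using independent_span_bound [OF finite_imageI [OF finite_high_fiber] indep sub] by (rule conjunct2)
  also have "\<dots> \<le> 2 ^ n"
    by (rule le_trans [OF card_image_le [OF finite_high_fiber] card_high_fiber])
  finally have "card (insert (ket M) ?W) \<le> 2 ^ n" .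
  moreover have "ket M \<notin> ?W"
    by (rule contrapos_nn [OF *]) (rule span_base)
  then have "card (insert (ket M) ?W) = Suc (2 ^ n)"
    using card_insert_disjoint [OF finite_imageI [OF finite_eigs]] card_image [OF inj] card_eigs
    by metis
  ultimately show False
    by linarith
qed

text \<open>An operator whose adjoint kills every basis vector is zero, because its matrix coefficients vanish. This
  is applied to \<open>q\<close>, whose conjugate polynomial vanishes at the same real points.\<close>

lemma op_poly_position_sum_eq_0:
  assumes "\<And>l. l \<in> eigs n \<Longrightarrow> poly q (complex_of_real l) = 0"
  shows "op_poly (position_sum n) q = 0"
proof -
  let ?S = "position_sum n"
  have ket: "op_poly ?S p (ket M) = 0" if "\<And>l. l \<in> eigs n \<Longrightarrow> poly p (complex_of_real l) = 0" for p M
  proof (rule linear_eq_0_on_span [OF _ _ ket_in_span_eigvec])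
    show "linear (blinfun_apply (op_poly ?S p))"
      by (simp add: blinfun.bounded_linear_right bounded_linear.linear)
  next
    fix w assume "w \<in> (\<lambda>l. eigvec n l (high n M)) ` eigs n"
    then show "op_poly ?S p w = 0"
      using that by (auto simp: op_poly_eigenvector [OF position_sum_eigvec clinear_position_sum]
          cscale_simps)
  qed
  have "op_poly ?S (map_poly cnj q) (ket M) = 0" for M
    using assms by (intro ket) (metis complex_cnj_complex_of_real complex_cnj_zero poly_cnj)
  moreover have "cinner (op_poly ?S q x) (ket M) = cinner x (op_poly ?S (map_poly cnj q) (ket M))"
    for x M
    using is_adjoint_op_poly [OF clinear_position_sum is_adjoint_position_sum]
    unfolding is_adjoint_def by blast
  ultimately have "coord (op_poly ?S q x) M = 0" for x M
    unfolding cinner_ket [symmetric] by (simp only: cinner_zero)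
  then show ?thesis
    by (intro blinfun_eqI) (simp add: coord_inject_ext zero_ell2.rep_eq)
qed

theorem theorem4p1:
  fixes n :: nat
  assumes "n \<ge> 1"
  shows "basic_measure (position_algebra n) (spectral_measure (position_algebra n) vacuum)"
proof -
  interpret finite_spectrum "position_sum n" "complex_of_real ` eigs n"
    "\<lambda>z. eigvec n (Re z) {}" vacuum
  proof
    show "op_poly (position_sum n) (\<Prod>l\<in>complex_of_real ` eigs n. [:- l, 1:]) = 0"
      by (rule op_poly_position_sum_eq_0) (auto simp: poly_prod finite_eigs)
    show "position_sum n (eigvec n (Re l) {}) = l *\<^sub>C eigvec n (Re l) {}"
      if "l \<in> complex_of_real ` eigs n" for l
      using that by (auto simp: position_sum_eigvec)
    show "cinner (eigvec n (Re l) {}) vacuum = 1" for l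
      by (simp add: vacuum_def cinner_ket eigvec.rep_eq high_def low_def Abs_mono_seq_inverse)
  qed (auto simp: finite_eigs clinear_position_sum is_adjoint_position_sum)
  show ?thesis
    unfolding position_algebra_def by (rule basic_measure_spectral_measure)
qed

end
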